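(* Let $a_k=1/k!$ for integers $k\ge 0$ and $a_k=0$ for $k<0$, and let $f$ be the entire function $$f(x)=S_6[e^x]=\sum_{k=0}^\infty \left(a_k^2-a_{k-6}\,a_{k+6}\right)x^k .$$ If $x_0=-43$, then $$(f'(x_0))^2-f(x_0)f''(x_0)<0 .$$
   Context: For a power series $\sum_{k\ge0}a_kx^k$, $S_6\left[\sum_{k\ge 0} a_kx^k\right]:=\sum_{k\ge 0}(a_k^2-a_{k-6}a_{k+6})x^k$, with $a_j=0$ for $j<0$. *)

theory Defs
  imports "HOL-Analysis.Analysis"
begin

definition int_coeff :: "'a::comm_ring_1 fps \<Rightarrow> int \<Rightarrow> 'a" where
  "int_coeff F j = (if j < 0 then 0 else fps_nth F (nat j))"

definition S6 :: "'a::comm_ring_1 fps \<Rightarrow> 'a fps" where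
  "S6 F = Abs_fps (\<lambda>k. (int_coeff F (int k))\<^sup>2 - int_coeff F (int k - 6) * int_coeff F (int k + 6))"

lemma int_coeff_exp:
  "int_coeff (fps_exp (1::complex)) j = (if j < 0 then 0 else 1 / fact (nat j))"
  by (simp add: int_coeff_def)

(* Outside its disc of convergence eval_fps carries no information, so the next three
   facts are what makes eval_fps (S6 (fps_exp 1)) the intended entire function. *)

lemma fps_conv_radius_S6_exp: "fps_conv_radius (S6 (fps_exp (1::complex))) = \<infinity>"
  unfolding fps_conv_radius_def
proof (rule conv_radius_inftyI'')
  fix z :: complex
  let ?a = "int_coeff (fps_exp (1::complex))"
  have bound: "norm (fps_nth (S6 (fps_exp (1::complex))) k) \<le> 2 / fact k" for k
  proof -
    have le1: "norm (?a j) \<le> 1" for j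
      by (simp add: int_coeff_exp norm_divide field_simps fact_ge_1)
    have k: "norm (?a (int k)) = 1 / fact k"
      by (simp add: int_coeff_exp norm_divide)
    have "nat (int k + 6) = k + 6"
      by simp
    then have k6: "norm (?a (int k + 6)) \<le> 1 / fact k"
      by (simp add: int_coeff_exp norm_divide frac_le fact_mono)
    have "norm (fps_nth (S6 (fps_exp (1::complex))) k)
        \<le> norm (?a (int k)) * norm (?a (int k)) + norm (?a (int k - 6)) * norm (?a (int k + 6))"
      unfolding S6_def fps_nth_Abs_fps power2_eq_square norm_mult[symmetric]
      by (rule norm_triangle_ineq4)
    also have "\<dots> \<le> 1 * (1 / fact k) + 1 * (1 / fact k)"
      by (intro add_mono mult_mono le1 k6) (use k in auto)
    finally show ?thesis by simp
  qed
  have "summable (\<lambda>k. 2 * (norm z ^ k /\<^sub>R fact k))"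
    by (intro summable_mult summable_exp_generic)
  moreover have "norm (fps_nth (S6 (fps_exp (1::complex))) k * z ^ k) \<le> 2 * (norm z ^ k /\<^sub>R fact k)" for k
    using mult_right_mono[OF bound[of k], of "norm z ^ k"]
    by (simp add: norm_mult norm_power field_simps)
  ultimately show "summable (\<lambda>k. fps_nth (S6 (fps_exp (1::complex))) k * z ^ k)"
    by (rule summable_comparison_test'[where N = 0])
qed

lemma S6_exp_sums:
  fixes a :: "int \<Rightarrow> complex"
  assumes "\<And>j. a j = (if j < 0 then 0 else 1 / fact (nat j))"
  shows "(\<lambda>k. ((a (int k))\<^sup>2 - a (int k - 6) * a (int k + 6)) * x ^ k) sums eval_fps (S6 (fps_exp 1)) x"
proof -
  have "a = int_coeff (fps_exp 1)"
    using assms by (simp add: fun_eq_iff int_coeff_exp)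
  moreover have "(\<lambda>k. fps_nth (S6 (fps_exp 1)) k * x ^ k) sums eval_fps (S6 (fps_exp 1)) x"
    by (rule sums_eval_fps) (simp add: fps_conv_radius_S6_exp)
  moreover have "fps_nth (S6 (fps_exp (1::complex))) k = (int_coeff (fps_exp 1) (int k))\<^sup>2
      - int_coeff (fps_exp 1) (int k - 6) * int_coeff (fps_exp 1) (int k + 6)" for k
    by (simp add: S6_def)
  ultimately show ?thesis
    by simp
qed

lemma S6_exp_holomorphic: "eval_fps (S6 (fps_exp (1::complex))) holomorphic_on UNIV"
  by (rule holomorphic_on_eval_fps) (simp add: fps_conv_radius_S6_exp)

end

theory Submission
  imports Defs
begin

text \<open>
  The values of \<open>f\<close>, \<open>f'\<close>, \<open>f''\<close> at \<open>-43\<close> are about \<open>-0.0535\<close>, \<open>0.00008\<close> and \<open>-0.00395\<close>: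
  the point lies next to a negative local maximum of \<open>f\<close> on the real line, where the Laguerre inequality
  \<open>f'\<^sup>2 - f f'' \<ge> 0\<close> must fail. It therefore suffices to know the three values roughly; the bounds
  \<open>f \<le> -1/20\<close>, \<open>\<bar>f'\<bar> \<le> 1/100\<close>, \<open>f'' \<le> -3/1000\<close> already give
  \<open>f'\<^sup>2 - f f'' \<le> 1/10000 - 3/20000 < 0\<close>.

  These bounds come from partial sums with one common tail estimate. The coefficients of \<open>f\<close>
  have absolute value at most \<open>1 / (k!)\<^sup>2\<close>, because a central binomial coefficient is the largest
  one in its row (lemma \<open>fact_square_le_spread\<close>). This majorant survives termwise differentiation
  (lemma \<open>diffs_bound\<close>), so lemma \<open>tail_bound\<close>, which compares the tail with a geometric series,
  serves \<open>f\<close>, \<open>f'\<close> and \<open>f''\<close> alike. Twenty terms leave an error below \<open>0.0002\<close>.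
\<close>

text \<open>
  Each side is \<open>(2k)!\<close> divided by a binomial coefficient of row \<open>2k\<close>: the left side by the
  central one, which is the largest of the row.
\<close>

lemma fact_square_le_spread:
  fixes j k :: nat
  assumes "j \<le> k"
  shows "(fact k)\<^sup>2 \<le> (fact (k - j) * fact (k + j) :: nat)"
proof -
  have sub: "2 * k - (k - j) = k + j" "2 * k - k = k"
    using assms by auto
  have "(fact k)\<^sup>2 * ((2 * k) choose k) = (fact (2 * k) :: nat)"
    using binomial_fact_lemma[of k "2 * k"] sub by (simp add: power2_eq_square)
  also have "\<dots> = fact (k - j) * fact (k + j) * ((2 * k) choose (k - j))"
    using binomial_fact_lemma[of "k - j" "2 * k"] sub by simp
  also have "\<dots> \<le> fact (k - j) * fact (k + j) * ((2 * k) choose k)"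
    by (intro mult_left_mono binomial_maximum') simp
  finally show ?thesis
    by simp
qed

definition S6_exp_coeff :: "nat \<Rightarrow> real" where
  "S6_exp_coeff k = 1 / (fact k)\<^sup>2 - (if k < 6 then 0 else 1 / (fact (k - 6) * fact (k + 6)))"

lemma fps_nth_S6_exp: "fps_nth (S6 (fps_exp (1::complex))) k = of_real (S6_exp_coeff k)"
proof -
  have "nat (int k + 6) = k + 6" "nat (int k - 6) = k - 6"
    by auto
  then show ?thesis
    by (simp add: S6_def int_coeff_exp S6_exp_coeff_def power_divide)
qed

lemma abs_S6_exp_coeff_le: "\<bar>S6_exp_coeff k\<bar> \<le> 1 / (fact k)\<^sup>2"
proof (cases "k < 6")
  case True
  then show ?thesis by (simp add: S6_exp_coeff_def)
next
  case False
  then have "real ((fact k)\<^sup>2) \<le> real (fact (k - 6) * fact (k + 6))"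
    by (intro of_nat_mono fact_square_le_spread) simp
  then have "1 / (fact (k - 6) * fact (k + 6)) \<le> 1 / (fact k :: real)\<^sup>2"
    by (intro frac_le) auto
  moreover have "0 \<le> 1 / (fact (k - 6) * fact (k + 6) :: real)"
    by simp
  ultimately show ?thesis
    using False by (simp add: S6_exp_coeff_def)
qed

text \<open>
  Of the two factors \<open>Suc k\<close> in \<open>((Suc k)!)\<^sup>2\<close>, one cancels the factor that the derivative
  brings down, and the other is dropped.
\<close>

lemma diffs_bound:
  fixes g :: "nat \<Rightarrow> real"
  assumes "\<And>k. \<bar>g k\<bar> \<le> 1 / (fact k)\<^sup>2"
  shows "\<bar>diffs g k\<bar> \<le> 1 / (fact k)\<^sup>2"
proof -
  have "\<bar>diffs g k\<bar> = real (Suc k) * \<bar>g (Suc k)\<bar>"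
    by (simp add: diffs_def abs_mult)
  also have "\<dots> \<le> real (Suc k) * (1 / (fact (Suc k))\<^sup>2)"
    by (intro mult_left_mono assms) simp
  also have "\<dots> = 1 / (fact k)\<^sup>2 * (1 / real (Suc k))"
    by (simp add: power2_eq_square divide_simps del: of_nat_Suc)
  also have "\<dots> \<le> 1 / (fact k)\<^sup>2"
    by (intro mult_right_le_one_le) auto
  finally show ?thesis .
qed

text \<open>
  From index \<open>N\<close> on, consecutive terms \<open>\<bar>x\<bar>\<^sup>k / (k!)\<^sup>2\<close> of the majorant have ratio
  \<open>\<bar>x\<bar> / (Suc k)\<^sup>2 \<le> 1/2\<close>.
\<close>

lemma tail_bound:
  fixes g :: "nat \<Rightarrow> real" and x :: real
  assumes g: "\<And>k. \<bar>g k\<bar> \<le> 1 / (fact k)\<^sup>2"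
    and N: "2 * \<bar>x\<bar> \<le> (real (Suc N))\<^sup>2"
  shows "summable (\<lambda>k. g k * x ^ k)"
    and "\<bar>(\<Sum>k. g k * x ^ k) - (\<Sum>k<N. g k * x ^ k)\<bar> \<le> 2 * (\<bar>x\<bar> ^ N / (fact N)\<^sup>2)"
proof -
  define u where "u k = \<bar>x\<bar> ^ k / (fact k)\<^sup>2" for k :: nat
  have geom: "u (n + N) \<le> u N * (1/2) ^ n" for n
  proof (induction n)
    case (Suc n)
    have "2 * \<bar>x\<bar> \<le> (real (Suc (n + N)))\<^sup>2"
      by (rule order_trans[OF N]) (intro power_mono, auto)
    then have "\<bar>x\<bar> / (real (Suc (n + N)))\<^sup>2 \<le> 1/2"
      by (simp add: divide_simps del: of_nat_Suc)
    moreover have "u (Suc n + N) = u (n + N) * (\<bar>x\<bar> / (real (Suc (n + N)))\<^sup>2)"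
      by (simp add: u_def power_mult_distrib mult.commute del: of_nat_Suc)
    ultimately have "u (Suc n + N) \<le> (u N * (1/2) ^ n) * (1/2)"
      using Suc.IH by (simp only:) (intro mult_mono, auto simp: u_def)
    then show ?case by simp
  qed simp
  have majorant: "norm (g k * x ^ k) \<le> u k" for k
    using mult_right_mono[OF g[of k], of "\<bar>x\<bar> ^ k"]
    by (simp add: u_def abs_mult power_abs)
  have le: "norm (g (n + N) * x ^ (n + N)) \<le> u N * (1/2) ^ n" for n
    using majorant geom order_trans by blast
  have sums: "(\<lambda>n. u N * (1/2) ^ n) sums (u N * 2)"
    using sums_mult[OF geometric_sums[of "1/2 :: real"], of "u N"] by simp
  have "summable (\<lambda>n. g (n + N) * x ^ (n + N))"
    by (rule summable_comparison_test'[OF sums_summable[OF sums], of 0]) (use le in auto)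
  then show summable: "summable (\<lambda>k. g k * x ^ k)"
    by (subst (asm) summable_iff_shift)
  have "norm (\<Sum>n. g (n + N) * x ^ (n + N)) \<le> u N * 2"
    using norm_suminf_le[OF le sums_summable[OF sums]] sums_unique[OF sums] by simp
  then show "\<bar>(\<Sum>k. g k * x ^ k) - (\<Sum>k<N. g k * x ^ k)\<bar> \<le> 2 * (\<bar>x\<bar> ^ N / (fact N)\<^sup>2)"
    using suminf_split_initial_segment[OF summable, of N] by (simp add: u_def mult.commute)
qed

text \<open>
  Twenty is the number of terms at which the tail bound \<open>2 * 43\<^sup>N / (N!)\<^sup>2\<close> is well below the
  size \<open>0.004\<close> of the second derivative; at \<open>N = 18\<close> it still exceeds that size.
\<close>

lemma eval_fps_approx:
  fixes F :: "complex fps" and g :: "nat \<Rightarrow> real"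
  assumes F: "\<And>k. fps_nth F k = of_real (g k)"
    and g: "\<And>k. \<bar>g k\<bar> \<le> 1 / (fact k)\<^sup>2"
  obtains y where "eval_fps F (-43) = of_real y"
    and "\<bar>y - (\<Sum>k<20. g k * (-43) ^ k)\<bar> \<le> 1 / 5000"
proof
  note tail = tail_bound[of g "-43" 20, OF g]
  have "eval_fps F (-43) = (\<Sum>k. of_real (g k * (-43) ^ k))"
    by (simp add: eval_fps_def F)
  also have "\<dots> = of_real (\<Sum>k. g k * (-43) ^ k)"
    by (rule suminf_of_real[symmetric], rule tail) simp
  finally show "eval_fps F (-43) = of_real (\<Sum>k. g k * (-43) ^ k)" .
  have "2 * (\<bar>- 43\<bar> ^ 20 / (fact 20)\<^sup>2) \<le> (1 / 5000 :: real)"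
    by (simp add: fact_numeral)
  moreover have "2 * \<bar>-43\<bar> \<le> (real (Suc 20))\<^sup>2"
    by simp
  ultimately show "\<bar>(\<Sum>k. g k * (-43) ^ k) - (\<Sum>k<20. g k * (-43) ^ k)\<bar> \<le> 1 / 5000"
    using tail(2) by (meson order_trans)
qed

lemma partial_sum_S6_exp: "(\<Sum>k<20. S6_exp_coeff k * (-43) ^ k) \<le> -53/1000"
  by (simp add: S6_exp_coeff_def lessThan_nat_numeral lessThan_Suc fact_numeral)

lemma partial_sum_deriv_S6_exp: "\<bar>\<Sum>k<20. diffs S6_exp_coeff k * (-43) ^ k\<bar> \<le> 1/1000"
  by (simp add: diffs_def S6_exp_coeff_def lessThan_nat_numeral lessThan_Suc fact_numeral)

lemma partial_sum_deriv2_S6_exp: "(\<Sum>k<20. diffs (diffs S6_exp_coeff) k * (-43) ^ k) \<le> -39/10000"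
  by (simp add: diffs_def S6_exp_coeff_def lessThan_nat_numeral lessThan_Suc fact_numeral)

theorem theorem15:
  fixes f :: "complex \<Rightarrow> complex" and x\<^sub>0 :: complex
  assumes "f = eval_fps (S6 (fps_exp 1))"
    and "x\<^sub>0 = -43"
  shows "(deriv f x\<^sub>0)\<^sup>2 - f x\<^sub>0 * deriv (deriv f) x\<^sub>0 \<in> \<real> \<and>
         Re ((deriv f x\<^sub>0)\<^sup>2 - f x\<^sub>0 * deriv (deriv f) x\<^sub>0) < 0"
proof -
  define F where "F = S6 (fps_exp (1::complex))"
  define c where "c = S6_exp_coeff"
  have radius: "fps_conv_radius F = \<infinity>"
    unfolding F_def by (rule fps_conv_radius_S6_exp)
  then have radius': "fps_conv_radius (fps_deriv F) = \<infinity>"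
    using fps_conv_radius_deriv[of F] by simp
  have deriv_f: "deriv f = eval_fps (fps_deriv F)"
    using radius by (simp add: assms(1) F_def eval_fps_deriv fun_eq_iff)
  have deriv2_f: "deriv (deriv f) = eval_fps (fps_deriv (fps_deriv F))"
    using radius' by (simp add: deriv_f eval_fps_deriv fun_eq_iff)

  have coeff: "fps_nth F k = of_real (c k)"
    and coeff': "fps_nth (fps_deriv F) k = of_real (diffs c k)"
    and coeff'': "fps_nth (fps_deriv (fps_deriv F)) k = of_real (diffs (diffs c) k)" for k
    by (simp_all add: F_def c_def fps_nth_S6_exp diffs_def)
  have bound: "\<bar>c k\<bar> \<le> 1 / (fact k)\<^sup>2" for k
    unfolding c_def by (rule abs_S6_exp_coeff_le)
  note bound' = diffs_bound[of c, OF bound]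
  note bound'' = diffs_bound[of "diffs c", OF bound']

  obtain y where y: "eval_fps F (-43) = of_real y"
      "\<bar>y - (\<Sum>k<20. c k * (-43) ^ k)\<bar> \<le> 1 / 5000"
    using eval_fps_approx[OF coeff bound] .
  obtain y' where y': "eval_fps (fps_deriv F) (-43) = of_real y'"
      "\<bar>y' - (\<Sum>k<20. diffs c k * (-43) ^ k)\<bar> \<le> 1 / 5000"
    using eval_fps_approx[OF coeff' bound'] .
  obtain y'' where y'': "eval_fps (fps_deriv (fps_deriv F)) (-43) = of_real y''"
      "\<bar>y'' - (\<Sum>k<20. diffs (diffs c) k * (-43) ^ k)\<bar> \<le> 1 / 5000"
    using eval_fps_approx[OF coeff'' bound''] .

  have "y \<le> -1/20"
    using y(2) partial_sum_S6_exp unfolding c_def by linarith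
  moreover have "y'' \<le> -3/1000"
    using y''(2) partial_sum_deriv2_S6_exp unfolding c_def by linarith
  ultimately have "(1/20) * (3/1000) \<le> (-y) * (-y'')"
    by (intro mult_mono) auto
  moreover have "\<bar>y'\<bar> \<le> 1/100"
    using y'(2) partial_sum_deriv_S6_exp unfolding c_def by linarith
  then have "y'\<^sup>2 \<le> (1/100)\<^sup>2"
    using power_mono[of "\<bar>y'\<bar>" "1/100" 2] by simp
  ultimately have "y'\<^sup>2 - y * y'' < 0"
    by (simp add: power2_eq_square)
  moreover have "(deriv f x\<^sub>0)\<^sup>2 - f x\<^sub>0 * deriv (deriv f) x\<^sub>0 = of_real (y'\<^sup>2 - y * y'')"
    using y(1) y'(1) y''(1) unfolding deriv2_f unfolding deriv_f assms(2)
    by (simp add: assms(1) F_def)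
  ultimately show ?thesis
    by (simp only: Reals_of_real Re_complex_of_real simp_thms)
qed

end
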